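(* Let $t_0\in\mathbb{R}$, $a>0$, $J=[t_0,t_0+a]$, let $g:J\to\mathbb{R}$ be nondecreasing and left-continuous, let $x_0\in\mathbb{R}^n$, and let $f,h:J\times\mathbb{R}^n\to\mathbb{R}^n$ be functions satisfying: (A1) For every $u\in\mathbb{R}^n$, the function $f(\cdot,u)$ is Kurzweil--Stieltjes integrable with respect to $g$ on $J$. (A2) There exists a function $M:J\to[0,\infty)$, Kurzweil--Stieltjes integrable with respect to $g$ on $J$, such that $\left\|\int_c^d f(s,u)\,\mathrm{d}g(s)\right\|\le\int_c^d M(s)\,\mathrm{d}g(s)$ for all $u\in\mathbb{R}^n$ and all $[c,d]\subseteq J$. (A3* ) For every $v\in\mathbb{R}^n$, the function $h(\cdot,v)$ is regulated on $J$, and there exists a function $\varphi:[0,\infty)\times[0,\infty)\to[0,\infty)$ such that for every $r\ge0$, $\varphi(\cdot,r)$ is a $\mathfrak{D}$-function satisfying $\varphi(t,r)<t$ for all $t>0$, and $\|h(t,u)-h(t,v)\|\le\varphi(\|u-v\|,r)$ for all $u,v\in\mathbb{R}^n$ with $\|u\|,\|v\|\le r$ and all $t\in J$. Assume further that $g$ is continuous and that, for every $v\in\mathbb{R}^n$, the function $h(\cdot,v)$ is continuous. Then every solution $x(\cdot)$ of the problem $$x(t)=x_0-h(t_0,x(t_0))+h(t,x(t))+\int_{t_0}^t f(s,x(s))\,\mathrm{d}g(s),\quad t\in J,\qquad x(t_0)=x_0,$$ is a continuous function.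
   Context: $\mathbb{R}^n$ carries a norm $\|\cdot\|$. A function $x:[a,b]\to X$ ($X$ a Banach space) is regulated if the one-sided limit $x(t^-)$ exists for every $t\in(a,b]$ and $x(t^+)$ exists for every $t\in[a,b)$. Kurzweil--Stieltjes integral: a gauge on $[a,b]$ is a function $\delta:[a,b]\to(0,\infty)$. A tagged partition $a=s_0\le s_1\le\dots\le s_k=b$ with tags $\tau_i\in[s_{i-1},s_i]$ is $\delta$-fine if $[s_{i-1},s_i]\subset(\tau_i-\delta(\tau_i),\tau_i+\delta(\tau_i))$ for all $i$. A function $f:[a,b]\to\mathbb{R}^n$ is Kurzweil--Stieltjes integrable with respect to $g:[a,b]\to\mathbb{R}$ if there is $\mathcal{I}\in\mathbb{R}^n$ such that for every $\varepsilon>0$ there is a gauge $\delta$ on $[a,b]$ with $\left\|\sum_{i=1}^k f(\tau_i)(g(s_i)-g(s_{i-1}))-\mathcal{I}\right\|<\varepsilon$ for all $\delta$-fine tagged partitions of $[a,b]$; then $\int_a^b f\,\mathrm{d}g:=\mathcal{I}$. All integrals are in this sense. A $\mathfrak{D}$-function is a continuous nondecreasing function $\psi:[0,\infty)\to[0,\infty)$ with $\psi(0)=0$ and $\psi(s)>0$ for $s>0$. A solution of the problem is a regulated function $x:J\to\mathbb{R}^n$ such that $t\mapsto h(t,x(t))$ is regulated on $J$, the integral equation holds for all $t\in J$ (with the integral existing in the Kurzweil--Stieltjes sense), and $x(t_0)=x_0$. *)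

theory Defs
  imports "HOL-Analysis.Analysis"
begin

definition is_norm :: "('a::real_vector \<Rightarrow> real) \<Rightarrow> bool" where
  "is_norm N \<longleftrightarrow>
     (\<forall>x. N x \<ge> 0) \<and> (\<forall>x. N x = 0 \<longleftrightarrow> x = 0) \<and>
     (\<forall>c x. N (c *\<^sub>R x) = \<bar>c\<bar> * N x) \<and>
     (\<forall>x y. N (x + y) \<le> N x + N y)"

definition regulated_on :: "real \<Rightarrow> real \<Rightarrow> (real \<Rightarrow> 'a::banach) \<Rightarrow> bool" where
  "regulated_on a b x \<longleftrightarrow>
     (\<forall>t\<in>{a<..b}. \<exists>L. (x \<longlongrightarrow> L) (at_left t)) \<and>
     (\<forall>t\<in>{a..<b}. \<exists>L. (x \<longlongrightarrow> L) (at_right t))"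

text \<open>The tag of the interval from \<open>s i\<close> to \<open>s (Suc i)\<close> is \<open>\<tau> i\<close>, for \<open>i < k\<close>.\<close>

definition tagged_partition ::
    "real \<Rightarrow> real \<Rightarrow> nat \<Rightarrow> (nat \<Rightarrow> real) \<Rightarrow> (nat \<Rightarrow> real) \<Rightarrow> bool" where
  "tagged_partition a b k s \<tau> \<longleftrightarrow>
     s 0 = a \<and> s k = b \<and> (\<forall>i<k. s i \<le> s (Suc i) \<and> \<tau> i \<in> {s i..s (Suc i)})"

definition delta_fine ::
    "(real \<Rightarrow> real) \<Rightarrow> nat \<Rightarrow> (nat \<Rightarrow> real) \<Rightarrow> (nat \<Rightarrow> real) \<Rightarrow> bool" where
  "delta_fine \<delta> k s \<tau> \<longleftrightarrow>
     (\<forall>i<k. {s i..s (Suc i)} \<subseteq> {\<tau> i - \<delta> (\<tau> i)<..<\<tau> i + \<delta> (\<tau> i)})"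

text \<open>The Kurzweil--Stieltjes integral over \<open>{a..b}\<close>, for \<open>a \<le> b\<close>; the norm \<open>N\<close> on the
  codomain is a parameter because it need not be the Euclidean one.\<close>

definition has_KS_integral ::
    "('a::real_vector \<Rightarrow> real) \<Rightarrow> (real \<Rightarrow> 'a) \<Rightarrow> (real \<Rightarrow> real) \<Rightarrow> real \<Rightarrow> real \<Rightarrow> 'a \<Rightarrow> bool" where
  "has_KS_integral N f g a b I \<longleftrightarrow>
     (\<forall>\<epsilon>>0. \<exists>\<delta>. (\<forall>t\<in>{a..b}. \<delta> t > 0) \<and>
        (\<forall>k s \<tau>. tagged_partition a b k s \<tau> \<and> delta_fine \<delta> k s \<tau> \<longrightarrow>
           N ((\<Sum>i<k. (g (s (Suc i)) - g (s i)) *\<^sub>R f (\<tau> i)) - I) < \<epsilon>))"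

definition KS_integrable ::
    "('a::real_vector \<Rightarrow> real) \<Rightarrow> (real \<Rightarrow> 'a) \<Rightarrow> (real \<Rightarrow> real) \<Rightarrow> real \<Rightarrow> real \<Rightarrow> bool" where
  "KS_integrable N f g a b \<longleftrightarrow> (\<exists>I. has_KS_integral N f g a b I)"

definition KS_integral ::
    "('a::real_vector \<Rightarrow> real) \<Rightarrow> (real \<Rightarrow> 'a) \<Rightarrow> (real \<Rightarrow> real) \<Rightarrow> real \<Rightarrow> real \<Rightarrow> 'a" where
  "KS_integral N f g a b = (THE I. has_KS_integral N f g a b I)"

definition D_function :: "(real \<Rightarrow> real) \<Rightarrow> bool" where
  "D_function \<psi> \<longleftrightarrow>
     \<psi> \<in> {0..} \<rightarrow> {0..} \<and> continuous_on {0..} \<psi> \<and> mono_on {0..} \<psi> \<and>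
     \<psi> 0 = 0 \<and> (\<forall>s>0. \<psi> s > 0)"

text \<open>Regularity is taken in the standard topology of \<open>real ^ 'n\<close>, which every norm \<open>N\<close>
  induces.\<close>

definition is_solution ::
    "(real ^ 'n \<Rightarrow> real) \<Rightarrow> (real \<Rightarrow> real ^ 'n \<Rightarrow> real ^ 'n) \<Rightarrow> (real \<Rightarrow> real ^ 'n \<Rightarrow> real ^ 'n) \<Rightarrow>
     (real \<Rightarrow> real) \<Rightarrow> real \<Rightarrow> real \<Rightarrow> real ^ 'n \<Rightarrow> (real \<Rightarrow> real ^ 'n) \<Rightarrow> bool" where
  "is_solution N f h g t0 a x0 x \<longleftrightarrow>
     regulated_on t0 (t0 + a) x \<and>
     regulated_on t0 (t0 + a) (\<lambda>t. h t (x t)) \<and>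
     (\<forall>t\<in>{t0..t0 + a}.
        KS_integrable N (\<lambda>s. f s (x s)) g t0 t \<and>
        x t = x0 - h t0 (x t0) + h t (x t) + KS_integral N (\<lambda>s. f s (x s)) g t0 t) \<and>
     x t0 = x0"

end

theory Submission
  imports Defs
begin

text \<open>
  Write \<open>b = t0 + a\<close> and \<open>F t\<close> for the integral of \<open>f s (x s)\<close> over \<open>{t0..t}\<close>, so that
  \<open>x t = c + h t (x t) + F t\<close> with \<open>c\<close> constant.

  Continuity of \<open>F\<close> is inherited from \<open>g\<close>. This is the one-interval case of the
  Saks--Henstock lemma (\<open>henstock_one_interval\<close>): on a small interval \<open>{c..d}\<close> tagged by
  \<open>t\<close>, the increment \<open>F d - F c\<close> differs from \<open>(g d - g c) *\<^sub>R f t (x t)\<close> by at most a fixed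
  multiple of the accuracy that the gauge guarantees on all of \<open>{t0..b}\<close>. Letting the interval
  shrink to \<open>t\<close> gives \<open>F s \<rightarrow> F t\<close>.

  Now let \<open>L\<close> be a one-sided limit of \<open>x\<close> at \<open>t\<close>. Since \<open>\<phi> d r < d\<close> for \<open>d > 0\<close>, every \<open>h s\<close>
  strictly decreases the distance of distinct points. Hence \<open>h s (x s) - h s L \<rightarrow> 0\<close> along with
  \<open>x s - L\<close>, while \<open>h s L \<rightarrow> h t L\<close> by continuity in time. Passing to the limit in the equation
  gives \<open>L = c + h t L + F t\<close>, the fixed-point equation that \<open>x t\<close> satisfies too. A map that
  strictly decreases distances has at most one fixed point, hence \<open>L = x t\<close>
  (\<open>contraction_limit_eq\<close>). Since \<open>x\<close> is regulated it has all one-sided limits, so it is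
  continuous.
\<close>

section \<open>Arbitrary norms on a Euclidean space\<close>

lemma is_normD:
  assumes "is_norm N"
  shows is_norm_nonneg: "N x \<ge> 0"
    and is_norm_eq_0_iff: "N x = 0 \<longleftrightarrow> x = 0"
    and is_norm_scaleR: "N (c *\<^sub>R x) = \<bar>c\<bar> * N x"
    and is_norm_triangle: "N (x + y) \<le> N x + N y"
  using assms unfolding is_norm_def by blast+

lemma is_norm_minus:
  assumes "is_norm N"
  shows "N (- x) = N x"
  using is_norm_scaleR[OF assms, of "-1" x] by simp

lemma is_norm_commute:
  assumes "is_norm N"
  shows "N (x - y) = N (y - x)"
  using is_norm_minus[OF assms, of "x - y"] by simp

lemma is_norm_triangle_sub:
  assumes "is_norm N"
  shows "N (x - z) \<le> N (x - y) + N (y - z)"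
  using is_norm_triangle[OF assms, of "x - y" "y - z"] by simp

text \<open>Expand \<open>x\<close> in the standard basis. This turns limits in the standard topology into limits
  with respect to \<open>N\<close>.\<close>

lemma is_norm_bounded:
  fixes N :: "'a::euclidean_space \<Rightarrow> real"
  assumes "is_norm N"
  obtains C where "\<And>x. N x \<le> C * norm x"
proof
  fix x :: 'a
  have sum_le: "N (\<Sum>i\<in>A. u i) \<le> (\<Sum>i\<in>A. N (u i))" if "finite A" for A and u :: "'a \<Rightarrow> 'a"
    using that
  proof (induction A)
    case empty
    show ?case using is_norm_eq_0_iff[OF assms, of 0] by simp
  next
    case (insert i A)
    then show ?case using is_norm_triangle[OF assms, of "u i" "\<Sum>i\<in>A. u i"] by simp
  qed
  have "N x = N (\<Sum>i\<in>Basis. (x \<bullet> i) *\<^sub>R i)"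
    by (simp add: euclidean_representation)
  also have "\<dots> \<le> (\<Sum>i\<in>Basis. N ((x \<bullet> i) *\<^sub>R i))"
    by (rule sum_le) simp
  also have "\<dots> = (\<Sum>i\<in>Basis. \<bar>x \<bullet> i\<bar> * N i)"
    by (simp only: is_norm_scaleR[OF assms])
  also have "\<dots> \<le> (\<Sum>i\<in>Basis. norm x * N i)"
    by (intro sum_mono mult_right_mono) (simp_all add: Basis_le_norm is_norm_nonneg[OF assms])
  finally show "N x \<le> (\<Sum>i\<in>Basis. N i) * norm x"
    by (simp add: sum_distrib_left mult.commute)
qed

lemma is_norm_tendsto_zero:
  fixes N :: "'a::euclidean_space \<Rightarrow> real"
  assumes N: "is_norm N" and "(u \<longlongrightarrow> L) F"
  shows "((\<lambda>s. N (u s - L)) \<longlongrightarrow> 0) F"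
proof -
  obtain C where C: "\<And>x. N x \<le> C * norm x" using is_norm_bounded[OF N] by blast
  have lim: "((\<lambda>s. C * norm (u s - L)) \<longlongrightarrow> 0) F"
    using assms(2) by (intro tendsto_mult_right_zero tendsto_norm_zero) (simp add: LIM_zero)
  show ?thesis
    by (rule tendsto_sandwich[OF _ _ tendsto_const lim]) (simp_all add: is_norm_nonneg[OF N] C)
qed

section \<open>Riemann--Stieltjes sums over fine partitions\<close>

text \<open>Working with the set of values of all fine sums hides the indexing of partitions: the
  arguments below only need that such sets are nonempty, additive over adjacent intervals and
  monotone in the gauge.\<close>

definition fine_sums ::
    "(real \<Rightarrow> real) \<Rightarrow> (real \<Rightarrow> 'a::real_vector) \<Rightarrow> (real \<Rightarrow> real) \<Rightarrow> real \<Rightarrow> real \<Rightarrow> 'a set" where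
  "fine_sums \<delta> f g a b =
     {(\<Sum>i<k. (g (s (Suc i)) - g (s i)) *\<^sub>R f (\<tau> i)) | k s \<tau>.
        tagged_partition a b k s \<tau> \<and> delta_fine \<delta> k s \<tau>}"

lemma has_KS_integral_fine_sums:
  "has_KS_integral N f g a b I \<longleftrightarrow>
     (\<forall>\<epsilon>>0. \<exists>\<delta>. (\<forall>t\<in>{a..b}. \<delta> t > 0) \<and> (\<forall>S\<in>fine_sums \<delta> f g a b. N (S - I) < \<epsilon>))"
proof -
  have "(\<forall>S\<in>fine_sums \<delta> f g a b. P S) \<longleftrightarrow>
      (\<forall>k s \<tau>. tagged_partition a b k s \<tau> \<and> delta_fine \<delta> k s \<tau> \<longrightarrow>
         P (\<Sum>i<k. (g (s (Suc i)) - g (s i)) *\<^sub>R f (\<tau> i)))" for \<delta> P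
    unfolding fine_sums_def by auto
  then show ?thesis
    unfolding has_KS_integral_def by simp
qed

lemma fine_sums_single:
  assumes "u \<le> t" "t \<le> v" "t - \<delta> t < u" "v < t + \<delta> t"
  shows "(g v - g u) *\<^sub>R f t \<in> fine_sums \<delta> f g u v"
proof -
  define s where "s i = (if i = 0 then u else v)" for i :: nat
  have "tagged_partition u v 1 s (\<lambda>_. t)" "delta_fine \<delta> 1 s (\<lambda>_. t)"
    using assms by (auto simp: s_def tagged_partition_def delta_fine_def)
  moreover have "(g v - g u) *\<^sub>R f t = (\<Sum>i<1. (g (s (Suc i)) - g (s i)) *\<^sub>R f t)"
    by (simp add: s_def)
  ultimately show ?thesis unfolding fine_sums_def mem_Collect_eq by (intro exI conjI)
qed

lemma fine_sums_append:
  assumes "S \<in> fine_sums \<delta> f g a b" "T \<in> fine_sums \<delta> f g b c"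
  shows "S + T \<in> fine_sums \<delta> f g a c"
proof -
  obtain k s \<tau> where 1: "tagged_partition a b k s \<tau>" "delta_fine \<delta> k s \<tau>"
    and S: "S = (\<Sum>i<k. (g (s (Suc i)) - g (s i)) *\<^sub>R f (\<tau> i))"
    using assms(1) unfolding fine_sums_def by blast
  obtain m s' \<tau>' where 2: "tagged_partition b c m s' \<tau>'" "delta_fine \<delta> m s' \<tau>'"
    and T: "T = (\<Sum>i<m. (g (s' (Suc i)) - g (s' i)) *\<^sub>R f (\<tau>' i))"
    using assms(2) unfolding fine_sums_def by blast
  define p where "p i = (if i < k then s i else s' (i - k))" for i
  define q where "q i = (if i < k then \<tau> i else \<tau>' (i - k))" for i
  \<comment> \<open>The two definitions of the node \<open>k\<close> agree, both being \<open>b\<close>.\<close>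
  have glue: "s k = s' 0" using 1(1) 2(1) by (simp add: tagged_partition_def)
  have left: "p i = s i \<and> p (Suc i) = s (Suc i) \<and> q i = \<tau> i" if "i < k" for i
  proof (cases "Suc i < k")
    case False
    with that have "Suc i = k" by simp
    then show ?thesis using glue by (auto simp: p_def q_def)
  qed (simp add: p_def q_def)
  have right: "p (k + i) = s' i \<and> p (Suc (k + i)) = s' (Suc i) \<and> q (k + i) = \<tau>' i" for i
    by (simp add: p_def q_def Suc_diff_le)
  have pieces: "(\<exists>j<k. p i = s j \<and> p (Suc i) = s (Suc j) \<and> q i = \<tau> j) \<or>
      (\<exists>j<m. p i = s' j \<and> p (Suc i) = s' (Suc j) \<and> q i = \<tau>' j)" if "i < k + m" for i
  proof (cases "i < k")
    case True
    then show ?thesis using left by blast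
  next
    case False
    then have "k + (i - k) = i" "i - k < m" using that by simp_all
    then show ?thesis using right[of "i - k"] by auto
  qed
  have "p 0 = a" "p (k + m) = c"
    using 1(1) 2(1) left[of 0] right[of m] by (auto simp: tagged_partition_def p_def)
  moreover have "p i \<le> p (Suc i) \<and> q i \<in> {p i..p (Suc i)}" if "i < k + m" for i
    using pieces[OF that] 1(1) 2(1) unfolding tagged_partition_def by (elim disjE exE) simp_all
  ultimately have tp: "tagged_partition a c (k + m) p q"
    unfolding tagged_partition_def by blast
  have "{p i..p (Suc i)} \<subseteq> {q i - \<delta> (q i)<..<q i + \<delta> (q i)}" if "i < k + m" for i
    using pieces[OF that]
  proof (elim disjE exE conjE)
    fix j assume "j < k" "p i = s j" "p (Suc i) = s (Suc j)" "q i = \<tau> j"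
    then show ?thesis using 1(2) unfolding delta_fine_def by simp
  next
    fix j assume "j < m" "p i = s' j" "p (Suc i) = s' (Suc j)" "q i = \<tau>' j"
    then show ?thesis using 2(2) unfolding delta_fine_def by simp
  qed
  then have df: "delta_fine \<delta> (k + m) p q"
    unfolding delta_fine_def by blast
  have split: "(\<Sum>i<k + m. F i) = (\<Sum>i<k. F i) + (\<Sum>i<m. F (k + i))" for F :: "nat \<Rightarrow> 'a"
    by (induction m) (simp_all add: add.assoc)
  have "S + T = (\<Sum>i<k + m. (g (p (Suc i)) - g (p i)) *\<^sub>R f (q i))"
    unfolding S T split by (simp add: left right)
  with tp df show ?thesis
    unfolding fine_sums_def mem_Collect_eq by (intro exI conjI)
qed

lemma fine_sums_mono:
  assumes "\<And>t. \<delta> t \<le> \<delta>' t"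
  shows "fine_sums \<delta> f g a b \<subseteq> fine_sums \<delta>' f g a b"
proof -
  have interval: "{u..v} \<subseteq> {t - \<delta>' t<..<t + \<delta>' t}"
    if "{u..v} \<subseteq> {t - \<delta> t<..<t + \<delta> t}" for u v t
    using that assms[of t] by force
  have "delta_fine \<delta>' k s \<tau>" if "delta_fine \<delta> k s \<tau>" for k s \<tau>
    using that interval unfolding delta_fine_def by simp
  then show ?thesis
    unfolding fine_sums_def by (intro Collect_mono ex_mono impI) (elim conjE, intro conjI)
qed

text \<open>Cousin's lemma, by bisection: having a fine partition is inherited from two adjacent
  intervals to their union, and short intervals around \<open>t\<close> are fine with the single tag \<open>t\<close>.\<close>

lemma fine_sums_nonempty:
  assumes "a \<le> b" "\<And>t. t \<in> {a..b} \<Longrightarrow> \<delta> t > 0"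
  shows "fine_sums \<delta> f g a b \<noteq> {}"
  using assms(1)
proof (induction rule: Bolzano)
  case (trans a b c)
  then show ?case using fine_sums_append by blast
next
  case (local t)
  show ?case
  proof (intro exI[of _ "\<delta> t"] conjI allI impI)
    show "0 < \<delta> t" using local assms(2) by simp
    fix u v assume *: "u \<le> t \<and> t \<le> v \<and> v - u < \<delta> t"
    have "t - \<delta> t < u" "v < t + \<delta> t" using * by linarith+
    then show "fine_sums \<delta> f g u v \<noteq> {}"
      using fine_sums_single[of u t v \<delta> g f] * by blast
  qed
qed

section \<open>Continuity of the indefinite integral\<close>

text \<open>Every value of the integral is approximated by sums that are moreover as fine as one likes;
  this lets one partition serve two gauges.\<close>

lemma has_KS_integral_approx:
  assumes "has_KS_integral N f g a b I" "a \<le> b" "\<epsilon> > 0" "\<And>t. t \<in> {a..b} \<Longrightarrow> \<delta> t > 0"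
  obtains S where "S \<in> fine_sums \<delta> f g a b" "N (S - I) < \<epsilon>"
proof -
  obtain \<delta>' where pos: "\<forall>t\<in>{a..b}. \<delta>' t > 0" and I: "\<forall>S\<in>fine_sums \<delta>' f g a b. N (S - I) < \<epsilon>"
    using assms(1,3) unfolding has_KS_integral_fine_sums by blast
  define \<eta> where "\<eta> t = min (\<delta> t) (\<delta>' t)" for t
  have "fine_sums \<eta> f g a b \<noteq> {}"
    using assms(2,4) pos by (intro fine_sums_nonempty) (auto simp: \<eta>_def)
  then obtain S where S: "S \<in> fine_sums \<eta> f g a b"
    by blast
  show ?thesis
  proof (rule that[of S])
    show "S \<in> fine_sums \<delta> f g a b"
      using S by (rule fine_sums_mono[THEN subsetD, rotated]) (simp add: \<eta>_def)
    have "S \<in> fine_sums \<delta>' f g a b"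
      using S by (rule fine_sums_mono[THEN subsetD, rotated]) (simp add: \<eta>_def)
    then show "N (S - I) < \<epsilon>"
      using I by simp
  qed
qed

lemma has_KS_integral_unique:
  assumes N: "is_norm N" and I: "has_KS_integral N f g a b I" and J: "has_KS_integral N f g a b J"
    and "a \<le> b"
  shows "I = J"
proof -
  have "N (I - J) < \<epsilon>" if "\<epsilon> > 0" for \<epsilon>
  proof -
    have "\<epsilon> / 2 > 0" using that by simp
    then obtain \<delta> where \<delta>: "\<forall>t\<in>{a..b}. \<delta> t > 0" "\<forall>S\<in>fine_sums \<delta> f g a b. N (S - I) < \<epsilon> / 2"
      using I unfolding has_KS_integral_fine_sums by blast
    obtain S where "S \<in> fine_sums \<delta> f g a b" "N (S - J) < \<epsilon> / 2"
      using has_KS_integral_approx[OF J \<open>a \<le> b\<close> \<open>\<epsilon> / 2 > 0\<close>, of \<delta>] \<delta>(1) by blast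
    then show ?thesis
      using \<delta>(2) is_norm_triangle_sub[OF N, of I J S] is_norm_commute[OF N, of I S] by force
  qed
  then have "\<not> N (I - J) > 0" by blast
  then have "N (I - J) = 0" using is_norm_nonneg[OF N, of "I - J"] by simp
  then show ?thesis by (simp add: is_norm_eq_0_iff[OF N])
qed

lemma has_KS_integral_KS_integral:
  assumes "is_norm N" "KS_integrable N f g a b" "a \<le> b"
  shows "has_KS_integral N f g a b (KS_integral N f g a b)"
proof -
  obtain I where I: "has_KS_integral N f g a b I"
    using assms(2) unfolding KS_integrable_def by blast
  have "J = I" if "has_KS_integral N f g a b J" for J
    by (rule has_KS_integral_unique[OF assms(1) that I assms(3)])
  with I show ?thesis
    unfolding KS_integral_def by (rule theI[where P = "has_KS_integral N f g a b"])
qed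

text \<open>The gauge \<open>\<delta>\<close> controls sums over all of \<open>{a..b}\<close>. Compare two \<open>\<delta>\<close>-fine partitions that
  agree on \<open>{d..b}\<close>: one continues a partition of \<open>{a..c}\<close> by the tagged interval \<open>{c..d}\<close>,
  the other uses a partition of \<open>{a..d}\<close>. Their sums are within \<open>2 * \<epsilon>\<close>, and the partitions of
  \<open>{a..c}\<close> and \<open>{a..d}\<close> can be chosen to give the integrals up to \<open>\<epsilon>\<close> each.\<close>

lemma henstock_one_interval:
  assumes N: "is_norm N" and "\<epsilon> > 0"
    and pos: "\<And>t. t \<in> {a..b} \<Longrightarrow> \<delta> t > 0"
    and \<delta>: "\<And>S. S \<in> fine_sums \<delta> f g a b \<Longrightarrow> N (S - I) < \<epsilon>"
    and Fc: "has_KS_integral N f g a c Fc" and Fd: "has_KS_integral N f g a d Fd"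
    and le: "a \<le> c" "c \<le> t" "t \<le> d" "d \<le> b"
    and fine: "t - \<delta> t < c" "d < t + \<delta> t"
  shows "N (Fd - Fc - (g d - g c) *\<^sub>R f t) < 4 * \<epsilon>"
proof -
  define T where "T = (g d - g c) *\<^sub>R f t"
  obtain P where P: "P \<in> fine_sums \<delta> f g a c" "N (P - Fc) < \<epsilon>"
    using has_KS_integral_approx[OF Fc _ \<open>\<epsilon> > 0\<close>, of \<delta>] pos le by auto
  obtain R where R: "R \<in> fine_sums \<delta> f g a d" "N (R - Fd) < \<epsilon>"
    using has_KS_integral_approx[OF Fd _ \<open>\<epsilon> > 0\<close>, of \<delta>] pos le by auto
  have "fine_sums \<delta> f g d b \<noteq> {}"
    using fine_sums_nonempty[of d b \<delta> f g] pos le by auto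
  then obtain Q where Q: "Q \<in> fine_sums \<delta> f g d b" by blast
  have "T \<in> fine_sums \<delta> f g c d"
    unfolding T_def using fine_sums_single le fine by blast
  then have 1: "N (P + T + Q - I) < \<epsilon>"
    using \<delta> fine_sums_append P(1) Q by blast
  have 2: "N (R + Q - I) < \<epsilon>"
    using \<delta> fine_sums_append R(1) Q by blast
  have "N ((Fd - Fc - T) - 0)
      \<le> N ((Fd - Fc - T) - (R - Fc - T)) + (N ((R - Fc - T) - (R - P - T)) + N ((R - P - T) - 0))"
    using is_norm_triangle_sub[OF N, of "Fd - Fc - T" 0 "R - Fc - T"]
      is_norm_triangle_sub[OF N, of "R - Fc - T" 0 "R - P - T"] by linarith
  moreover have "N ((Fd - Fc - T) - (R - Fc - T)) = N (R - Fd)"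
    using is_norm_commute[OF N, of R Fd] by simp
  moreover have "N ((R - Fc - T) - (R - P - T)) = N (P - Fc)"
    by simp
  moreover have "N (R - P - T) \<le> N (R + Q - I) + N (P + T + Q - I)"
    using is_norm_triangle_sub[OF N, of "R + Q - I" "P + T + Q - I" 0]
      is_norm_commute[OF N, of 0 "P + T + Q - I"] by (simp add: algebra_simps)
  ultimately show ?thesis using 1 2 P(2) R(2) unfolding T_def by simp
qed

lemma KS_indefinite_integral_tendsto:
  assumes N: "is_norm N"
    and F: "\<And>s. s \<in> {a..b} \<Longrightarrow> has_KS_integral N f g a s (F s)"
    and g: "continuous_on {a..b} g" and t: "t \<in> {a..b}"
  shows "((\<lambda>s. N (F s - F t)) \<longlongrightarrow> 0) (at t within {a..b})"
proof (rule tendstoI)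
  fix e :: real assume "e > 0"
  define \<epsilon> where "\<epsilon> = e / 8"
  have "\<epsilon> > 0" using \<open>e > 0\<close> by (simp add: \<epsilon>_def)
  have "has_KS_integral N f g a b (F b)" using F t by simp
  then obtain \<delta> where pos: "\<forall>s\<in>{a..b}. \<delta> s > 0"
      and \<delta>: "\<forall>S\<in>fine_sums \<delta> f g a b. N (S - F b) < \<epsilon>"
    using \<open>\<epsilon> > 0\<close> unfolding has_KS_integral_fine_sums by blast
  have "((\<lambda>s. \<bar>g s - g t\<bar> * N (f t)) \<longlongrightarrow> \<bar>g t - g t\<bar> * N (f t)) (at t within {a..b})"
    using g t by (intro tendsto_intros) (auto simp: continuous_on_def)
  then have small: "\<forall>\<^sub>F s in at t within {a..b}. \<bar>g s - g t\<bar> * N (f t) < e / 2"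
    using \<open>e > 0\<close> by (intro order_tendstoD(2)) auto
  have near: "\<forall>\<^sub>F s in at t within {a..b}. s \<in> {a..b} \<and> \<bar>s - t\<bar> < \<delta> t"
    using pos t unfolding eventually_at by (intro exI[of _ "\<delta> t"]) (auto simp: dist_real_def)
  show "\<forall>\<^sub>F s in at t within {a..b}. dist (N (F s - F t)) 0 < e"
    using small near
  proof eventually_elim
    case (elim s)
    have "N (F s - F t - (g s - g t) *\<^sub>R f t) < 4 * \<epsilon>"
    proof (cases "t \<le> s")
      case True
      then show ?thesis
        using pos \<delta> F t elim
        by (intro henstock_one_interval[OF N \<open>\<epsilon> > 0\<close>, where a = a and b = b and \<delta> = \<delta> and I = "F b"])
          auto
    next
      case False
      then have "N (F t - F s - (g t - g s) *\<^sub>R f t) < 4 * \<epsilon>"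
        using pos \<delta> F t elim
        by (intro henstock_one_interval[OF N \<open>\<epsilon> > 0\<close>, where a = a and b = b and \<delta> = \<delta> and I = "F b"])
          auto
      moreover have "F t - F s - (g t - g s) *\<^sub>R f t = - (F s - F t - (g s - g t) *\<^sub>R f t)"
        by (simp add: algebra_simps)
      ultimately show ?thesis by (simp only: is_norm_minus[OF N])
    qed
    moreover have "N ((g s - g t) *\<^sub>R f t) = \<bar>g s - g t\<bar> * N (f t)"
      by (rule is_norm_scaleR[OF N])
    moreover have "N (F s - F t) \<ge> 0"
      by (rule is_norm_nonneg[OF N])
    moreover have "N (F s - F t) \<le> N (F s - F t - (g s - g t) *\<^sub>R f t) + N ((g s - g t) *\<^sub>R f t)"
      using is_norm_triangle_sub[OF N, of "F s - F t" 0 "(g s - g t) *\<^sub>R f t"] by simp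
    ultimately show ?case using elim by (simp add: \<epsilon>_def)
  qed
qed

section \<open>Limits of solutions of the fixed-point equation\<close>

text \<open>Both \<open>L\<close> and \<open>x t\<close> solve \<open>u = y t + h t u\<close>, and a strict contraction has at most one
  fixed point. In the application \<open>G\<close> is a one-sided neighbourhood filter of \<open>t\<close>. Because
  \<open>h s\<close> moves \<open>x s\<close> and \<open>L\<close> no further apart, \<open>h s (x s)\<close> follows \<open>h s L\<close> along \<open>G\<close>
  although no joint continuity of \<open>h\<close> is known.\<close>

lemma contraction_limit_eq:
  fixes N :: "'a::euclidean_space \<Rightarrow> real"
  assumes N: "is_norm N" and G: "G \<noteq> bot" "\<forall>\<^sub>F s in G. s \<in> J" and t: "t \<in> J"
    and contr: "\<And>s u v. s \<in> J \<Longrightarrow> u \<noteq> v \<Longrightarrow> N (h s u - h s v) < N (u - v)"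
    and eq: "\<And>s. s \<in> J \<Longrightarrow> x s = y s + h s (x s)"
    and L: "(x \<longlongrightarrow> L) G"
    and hL: "((\<lambda>s. h s L) \<longlongrightarrow> h t L) G"
    and y: "((\<lambda>s. N (y s - y t)) \<longlongrightarrow> 0) G"
  shows "L = x t"
proof (rule ccontr)
  assume "L \<noteq> x t"
  define B where "B s = N (x s - L) + N (x s - L) + N (y s - y t) + N (h s L - h t L)" for s
  have "(B \<longlongrightarrow> 0 + 0 + 0 + 0) G"
    unfolding B_def by (intro tendsto_add y is_norm_tendsto_zero[OF N] L hL)
  moreover have "\<forall>\<^sub>F s in G. N (L - (y t + h t L)) \<le> B s"
    using G(2)
  proof eventually_elim
    case (elim s)
    have "N (L - (y t + h t L)) \<le> N (L - x s) + N (x s - (y t + h t L))"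
      by (rule is_norm_triangle_sub[OF N])
    also have "N (x s - (y t + h t L))
        \<le> N (x s - (y s + h s L)) + N ((y s + h s L) - (y t + h t L))"
      by (rule is_norm_triangle_sub[OF N])
    also have "N ((y s + h s L) - (y t + h t L))
        \<le> N ((y s + h s L) - (y t + h s L)) + N ((y t + h s L) - (y t + h t L))"
      by (rule is_norm_triangle_sub[OF N])
    also have "N (x s - (y s + h s L)) \<le> N (x s - L)"
    proof (cases "x s = L")
      case True
      then show ?thesis using eq[OF elim] by simp
    next
      case False
      have diff: "x s - (y s + h s L) = h s (x s) - h s L"
        using eq[OF elim] by (simp add: algebra_simps)
      show ?thesis
        unfolding diff using contr[OF elim False] by (rule less_imp_le)
    qed
    finally show ?case
      using is_norm_commute[OF N, of L "x s"] by (simp add: B_def)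
  qed
  ultimately have "N (L - (y t + h t L)) \<le> 0"
    using tendsto_lowerbound[OF _ _ G(1), of B] by simp
  then have "N (L - (y t + h t L)) = 0"
    using is_norm_nonneg[OF N, of "L - (y t + h t L)"] by simp
  then have "L = y t + h t L"
    by (simp add: is_norm_eq_0_iff[OF N])
  then have "L - x t = (y t + h t L) - (y t + h t (x t))"
    using eq[OF t] by argo
  then have "L - x t = h t L - h t (x t)"
    by simp
  with contr[OF t \<open>L \<noteq> x t\<close>] show False by simp
qed

lemma at_left_le_at_within_Icc:
  fixes t :: real
  assumes "a < t" "t \<le> b"
  shows "at_left t \<le> at t within {a..b}"
  unfolding at_within_Icc_at_left[OF assms(1), symmetric] using assms by (intro at_le) auto

lemma at_right_le_at_within_Icc:
  fixes t :: real
  assumes "a \<le> t" "t < b"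
  shows "at_right t \<le> at t within {a..b}"
  unfolding at_within_Icc_at_right[OF assms(2), symmetric] using assms by (intro at_le) auto

lemma continuous_on_Icc_one_sided:
  fixes x :: "real \<Rightarrow> 'a::topological_space"
  assumes left: "\<And>t. a < t \<Longrightarrow> t \<le> b \<Longrightarrow> (x \<longlongrightarrow> x t) (at_left t)"
    and right: "\<And>t. a \<le> t \<Longrightarrow> t < b \<Longrightarrow> (x \<longlongrightarrow> x t) (at_right t)"
  shows "continuous_on {a..b} x"
  unfolding continuous_on_def
proof
  fix t assume t: "t \<in> {a..b}"
  have point: "at u within {u} = bot" for u :: real by (simp add: at_within_def)
  have "(x \<longlongrightarrow> x t) (at t within {a..t})"
    using left[of t] t by (cases "a < t") (auto simp: at_within_Icc_at_left point)
  moreover have "(x \<longlongrightarrow> x t) (at t within {t..b})"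
    using right[of t] t by (cases "t < b") (auto simp: at_within_Icc_at_right point)
  ultimately have "(x \<longlongrightarrow> x t) (at t within {a..t} \<union> {t..b})"
    by (rule Lim_Un)
  then show "(x \<longlongrightarrow> x t) (at t within {a..b})"
    using t by (simp add: ivl_disj_un_two_touch)
qed

section \<open>Continuity of solutions\<close>

theorem proposition4p1:
  fixes N :: "real ^ 'n \<Rightarrow> real"
    and t0 a :: real
    and g :: "real \<Rightarrow> real"
    and x0 :: "real ^ 'n"
    and f h :: "real \<Rightarrow> real ^ 'n \<Rightarrow> real ^ 'n"
    and x :: "real \<Rightarrow> real ^ 'n"
  assumes norm: "is_norm N"
    and a: "a > 0"
    and g_mono: "mono_on {t0..t0 + a} g"
    and g_left: "\<forall>t\<in>{t0<..t0 + a}. continuous (at_left t) g"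
    and A1: "\<forall>u. KS_integrable N (\<lambda>s. f s u) g t0 (t0 + a)"
    and A2: "\<exists>M. (\<forall>s\<in>{t0..t0 + a}. M s \<ge> 0) \<and> KS_integrable abs M g t0 (t0 + a) \<and>
               (\<forall>u c d. t0 \<le> c \<and> c \<le> d \<and> d \<le> t0 + a \<longrightarrow>
                  N (KS_integral N (\<lambda>s. f s u) g c d) \<le> KS_integral abs M g c d)"
    and A3_regulated: "\<forall>v. regulated_on t0 (t0 + a) (\<lambda>t. h t v)"
    and A3_contraction: "\<exists>\<phi> :: real \<Rightarrow> real \<Rightarrow> real. \<forall>r\<ge>0.
               D_function (\<lambda>t. \<phi> t r) \<and> (\<forall>t>0. \<phi> t r < t) \<and>
               (\<forall>u v. N u \<le> r \<and> N v \<le> r \<longrightarrow>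
                  (\<forall>t\<in>{t0..t0 + a}. N (h t u - h t v) \<le> \<phi> (N (u - v)) r))"
    and g_cont: "continuous_on {t0..t0 + a} g"
    and h_cont: "\<forall>v. continuous_on {t0..t0 + a} (\<lambda>t. h t v)"
    and sol: "is_solution N f h g t0 a x0 x"
  shows "continuous_on {t0..t0 + a} x"
proof -
  define b where "b = t0 + a"
  define F where "F t = KS_integral N (\<lambda>s. f s (x s)) g t0 t" for t
  define y where "y t = x0 - h t0 (x t0) + F t" for t
  have F: "has_KS_integral N (\<lambda>s. f s (x s)) g t0 t (F t)" if "t \<in> {t0..b}" for t
    using sol that norm unfolding is_solution_def F_def b_def
    by (intro has_KS_integral_KS_integral) auto
  have eq: "x t = y t + h t (x t)" if "t \<in> {t0..b}" for t
    using sol that unfolding is_solution_def y_def F_def b_def by (auto simp: algebra_simps)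
  have y: "((\<lambda>s. N (y s - y t)) \<longlongrightarrow> 0) (at t within {t0..b})" if "t \<in> {t0..b}" for t
    using KS_indefinite_integral_tendsto[OF norm F _ that] g_cont by (simp add: y_def b_def)
  obtain \<phi> where "\<forall>r\<ge>0. D_function (\<lambda>t. \<phi> t r) \<and> (\<forall>t>0. \<phi> t r < t) \<and>
      (\<forall>u v. N u \<le> r \<and> N v \<le> r \<longrightarrow>
         (\<forall>t\<in>{t0..b}. N (h t u - h t v) \<le> \<phi> (N (u - v)) r))"
    using A3_contraction unfolding b_def by (elim exE)
  then have \<phi>: "\<And>t. t > 0 \<Longrightarrow> \<phi> t r < t"
      "\<And>s u v. N u \<le> r \<Longrightarrow> N v \<le> r \<Longrightarrow> s \<in> {t0..b} \<Longrightarrow> N (h s u - h s v) \<le> \<phi> (N (u - v)) r"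
    if "r \<ge> 0" for r
    using that by simp_all
  have contr: "N (h s u - h s v) < N (u - v)" if "s \<in> {t0..b}" "u \<noteq> v" for s u v
  proof -
    \<comment> \<open>The strict contraction holds on every ball, so each pair may use its own radius.\<close>
    define r where "r = max (N u) (N v)"
    have "r \<ge> 0" "N u \<le> r" "N v \<le> r" by (auto simp: r_def le_max_iff_disj is_norm_nonneg[OF norm])
    then have "N (h s u - h s v) \<le> \<phi> (N (u - v)) r"
      using \<phi>(2)[of r u v s] that(1) by simp
    moreover have "N (u - v) > 0"
      using that(2) is_norm_nonneg[OF norm, of "u - v"] is_norm_eq_0_iff[OF norm, of "u - v"] by simp
    ultimately show ?thesis using \<phi>(1)[OF \<open>r \<ge> 0\<close>, of "N (u - v)"] by linarith
  qed
  have limit: "(x \<longlongrightarrow> x t) G"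
    if t: "t \<in> {t0..b}" and G: "G \<noteq> bot" "G \<le> at t within {t0..b}"
      and ex: "\<exists>L. (x \<longlongrightarrow> L) G" for t G
  proof -
    obtain L where L: "(x \<longlongrightarrow> L) G" using ex by blast
    have "\<forall>\<^sub>F s in at t within {t0..b}. s \<in> {t0..b}"
      by (simp add: eventually_at_topological) blast
    then have "\<forall>\<^sub>F s in G. s \<in> {t0..b}"
      using G(2) by (rule filter_leD[rotated])
    moreover have "((\<lambda>s. h s L) \<longlongrightarrow> h t L) G"
      using h_cont t unfolding continuous_on_def b_def[symmetric]
      by (intro tendsto_mono[OF G(2)]) simp
    moreover have "((\<lambda>s. N (y s - y t)) \<longlongrightarrow> 0) G"
      by (rule tendsto_mono[OF G(2) y[OF t]])
    ultimately have "L = x t"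
      using contraction_limit_eq[where J = "{t0..b}" and h = h and y = y, OF norm G(1) _ t contr eq L]
      by blast
    with L show ?thesis by simp
  qed
  have "regulated_on t0 b x" using sol by (simp add: is_solution_def b_def)
  then have "continuous_on {t0..b} x"
    unfolding regulated_on_def
    by (intro continuous_on_Icc_one_sided limit)
      (auto intro: at_left_le_at_within_Icc at_right_le_at_within_Icc)
  then show ?thesis by (simp add: b_def)
qed

end
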